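(* $\mathcal{EE}\cap\mathrm{Perf}=\mathfrak{P}_2\cap\mathrm{Perf}$.
   Context: $2^\omega$ is the Cantor space with its standard product probability measure, $[\omega]^\omega$ is the family of infinite subsets of $\omega$, and $\mathrm{Perf}$ is the class of all perfect subsets of $2^\omega$ (closed sets without isolated points). $\mathcal{E}$ is the $\sigma$-ideal on $2^\omega$ generated by closed null subsets of $2^\omega$ (i.e. all subsets of countable unions of closed null sets). For $S\in[\omega]^\omega$ with increasing enumeration $S=\{s_0<s_1<\dots\}$, let $\tilde s:2^\omega\to 2^S$ be the bijection $\tilde s(x)(s_i)=x(i)$, and for $A\subseteq 2^S$ let $A\in\mathcal{E}(2^S)$ iff $\tilde s^{-1}[A]\in\mathcal{E}$. For $X\subseteq 2^\omega$, $X\restriction S=\{x\restriction S:x\in X\}\subseteq 2^S$. Define $\mathcal{EE}=\{X\subseteq 2^\omega:(\forall S\in[\omega]^\omega)\ X\restriction S\in\mathcal{E}(2^S)\}$ and $\mathfrak{P}_2=\{X\subseteq 2^\omega:(\forall S\in[\omega]^\omega)\ X\restriction S\neq 2^S\}$. *)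

theory Defs
  imports "HOL-Probability.Probability"
begin

text \<open>
  The Cantor space is the type \<^typ>\<open>nat \<Rightarrow> bool\<close> with the product topology of the library
  (\<^typ>\<open>bool\<close> is discrete). For \<open>S \<subseteq> \<omega>\<close>, elements of \<open>2\<^sup>S\<close> are functions
  that are \<^const>\<open>undefined\<close> outside \<open>S\<close>, so that the restriction of \<open>x\<close> to \<open>S\<close> is
  \<^term>\<open>restrict x S\<close>.
\<close>

type_synonym cantor = "nat \<Rightarrow> bool"

definition cantor_measure :: "cantor measure" where
  "cantor_measure = (\<Pi>\<^sub>M i\<in>UNIV. measure_pmf (bernoulli_pmf (1/2)))"

definition cantor_on :: "nat set \<Rightarrow> cantor set" where
  "cantor_on S = (\<Pi>\<^sub>E i\<in>S. UNIV)"

definition restrict_set :: "cantor set \<Rightarrow> nat set \<Rightarrow> cantor set" where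
  "restrict_set X S = (\<lambda>x. restrict x S) ` X"

definition Perf :: "cantor set set" where
  "Perf = {X. closed X \<and> (\<forall>x\<in>X. \<not> x isolated_in X)}"

definition ideal_E :: "cantor set set" where
  "ideal_E = {A. \<exists>F :: nat \<Rightarrow> cantor set.
     (\<forall>n. closed (F n) \<and> F n \<in> null_sets cantor_measure) \<and> A \<subseteq> (\<Union>n. F n)}"

text \<open>
  \<^term>\<open>enumerate S\<close> is the increasing enumeration of an infinite set \<open>S\<close>, so the inverse below
  takes the \<open>i\<close>-th element of \<open>S\<close> to \<open>i\<close>.
\<close>

definition relabel :: "nat set \<Rightarrow> cantor \<Rightarrow> cantor" where
  "relabel S x = (\<lambda>n\<in>S. x (inv (enumerate S) n))"

lemma relabel_enumerate:
  assumes "infinite S"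
  shows "relabel S x (enumerate S i) = x i"
  using assms
  by (simp add: relabel_def enumerate_in_set inv_f_f strict_mono_enumerate strict_mono_imp_inj_on)

lemma bij_betw_relabel:
  assumes "infinite S"
  shows "bij_betw (relabel S) UNIV (cantor_on S)"
proof (rule bij_betw_byWitness[where f' = "\<lambda>y i. y (enumerate S i)"])
  show "\<forall>x\<in>UNIV. (\<lambda>i. relabel S x (enumerate S i)) = x"
    using assms by (simp add: relabel_enumerate)
  show "\<forall>y\<in>cantor_on S. relabel S (\<lambda>i. y (enumerate S i)) = y"
  proof
    fix y assume y: "y \<in> cantor_on S"
    have "enumerate S (inv (enumerate S) n) = n" if "n \<in> S" for n
      using that assms by (simp add: f_inv_into_f range_enumerate)
    with y show "relabel S (\<lambda>i. y (enumerate S i)) = y"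
      by (auto simp: relabel_def cantor_on_def fun_eq_iff PiE_def extensional_def)
  qed
qed (auto simp: relabel_def cantor_on_def)

definition ideal_E_on :: "nat set \<Rightarrow> cantor set set" where
  "ideal_E_on S = {A. A \<subseteq> cantor_on S \<and> relabel S -` A \<in> ideal_E}"

definition EE :: "cantor set set" where
  "EE = {X. \<forall>S. infinite S \<longrightarrow> restrict_set X S \<in> ideal_E_on S}"

definition P2 :: "cantor set set" where
  "P2 = {X. \<forall>S. infinite S \<longrightarrow> restrict_set X S \<noteq> cantor_on S}"

end

theory Submission
  imports Defs
begin

text \<open>
  A set in \<open>EE\<close> cannot restrict onto all of \<open>2\<^sup>S\<close>, because the whole Cantor space is not null.
  The content is the converse for a perfect, hence compact, set \<open>X\<close>. Reading \<open>X\<close> along an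
  infinite set \<open>S\<close> gives a compact set \<open>C\<close>. If \<open>C\<close> is null, it is itself the required closed null
  cover. Otherwise \<open>C\<close> has positive measure, and then it restricts onto all of \<open>2\<^sup>T\<close> for some
  infinite \<open>T\<close> (\<open>closed_positive_ex_full_restriction\<close>); the image of \<open>T\<close> under the enumeration of
  \<open>S\<close> shows that \<open>X\<close> is not in \<open>P2\<close>.

  To find \<open>T\<close>, note that a set of positive measure can fix only finitely many of its coordinates up
  to null sets (\<open>finite_determined_coordinates\<close>): fixing infinitely many independent fair bits
  has probability \<open>0\<close>. So a finite set of coordinates on which every pattern occurs in \<open>C\<close> with
  positive measure can always be enlarged by a new coordinate: only finitely many patterns are
  involved, and each excludes only finitely many coordinates. Iterating gives \<open>T\<close> such that all
  finite patterns on \<open>T\<close> occur in \<open>C\<close>, and compactness turns this into all patterns on \<open>T\<close>.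
\<close>

section \<open>Topology and measure of cylinders\<close>

definition cylinder :: "nat set \<Rightarrow> cantor \<Rightarrow> cantor set" where
  "cylinder F s = {x. \<forall>i\<in>F. x i = s i}"

lemma compact_UNIV_cantor: "compact (UNIV :: cantor set)"
proof -
  have "compact_space (product_topology (\<lambda>_::nat. euclidean :: bool topology) UNIV)"
    unfolding compact_space_product_topology
    by (simp add: compact_space_def finite_imp_compact)
  then show ?thesis
    by (simp only: compact_space_def euclidean_product_topology compactin_euclidean_iff
        topspace_euclidean)
qed

lemma Hausdorff_space_euclidean_t2: "Hausdorff_space (euclidean :: 'a :: t2_space topology)"
  unfolding Hausdorff_space_def disjnt_def open_openin[symmetric] topspace_euclidean
  using hausdorff by metis

lemma compact_imp_closed_cantor:
  fixes C :: "cantor set"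
  assumes "compact C"
  shows "closed C"
proof -
  have "Hausdorff_space (product_topology (\<lambda>_::nat. euclidean :: bool topology) UNIV)"
    unfolding Hausdorff_space_product_topology by (simp add: Hausdorff_space_euclidean_t2)
  then show ?thesis
    using assms compactin_imp_closedin[of "euclidean :: cantor topology" C]
    by (simp add: euclidean_product_topology)
qed

lemma closed_cylinder: "closed (cylinder F s)"
proof -
  have "closed {x :: cantor. x i = s i}" for i
    by (rule closed_Collect_eq) (auto intro: continuous_intros)
  then have "closed (\<Inter>i\<in>F. {x :: cantor. x i = s i})"
    by auto
  also have "(\<Inter>i\<in>F. {x. x i = s i}) = cylinder F s"
    by (auto simp: cylinder_def)
  finally show ?thesis .
qed

text \<open>
  Second countability of the factors is what makes the Borel sets of the product topology coincide
  with the product \<open>\<sigma>\<close>-algebra.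
\<close>

instance bool :: second_countable_topology
proof
  have "generate_topology UNIV U" for U :: "bool set"
    by (rule generate_topology.Basis) simp
  then have "open = generate_topology (UNIV :: bool set set)"
    using Topological_Spaces.open_discrete[where 'a=bool] by (intro ext) simp
  then show "\<exists>B :: bool set set. countable B \<and> open = generate_topology B"
    using countable_finite[OF finite] by blast
qed

lemma sets_cantor_measure: "sets cantor_measure = sets borel"
proof -
  have "sets cantor_measure = sets (\<Pi>\<^sub>M i\<in>(UNIV :: nat set). (borel :: bool measure))"
    unfolding cantor_measure_def by (intro sets_PiM_cong) (simp_all add: sets_borel_eq_count_space)
  then show ?thesis
    by (simp add: sets_PiM_equal_borel)
qed

lemma closed_in_sets_cantor: "closed C \<Longrightarrow> C \<in> sets cantor_measure"
  by (simp add: sets_cantor_measure)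

lemma emeasure_cylinder:
  assumes "finite F"
  shows "emeasure cantor_measure (cylinder F s) = ennreal ((1/2) ^ card F)"
proof -
  have "cylinder F s = prod_emb UNIV (\<lambda>_. measure_pmf (bernoulli_pmf (1/2))) F (\<Pi>\<^sub>E i\<in>F. {s i})"
    by (intro set_eqI) (simp add: cylinder_def prod_emb_iff PiE_iff)
  then have "emeasure cantor_measure (cylinder F s)
      = (\<Prod>i\<in>F. emeasure (measure_pmf (bernoulli_pmf (1/2))) {s i})"
    unfolding cantor_measure_def using assms
    by (simp only:) (rule emeasure_PiM_emb; simp add: prob_space_measure_pmf)
  also have "\<dots> = (\<Prod>i\<in>F. ennreal (1/2))"
  proof (rule prod.cong)
    fix i
    show "emeasure (measure_pmf (bernoulli_pmf (1/2))) {s i} = ennreal (1/2)"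
      by (cases "s i") (simp_all add: emeasure_pmf_single)
  qed simp
  also have "\<dots> = ennreal ((1/2) ^ card F)"
    by (subst prod_ennreal) simp_all
  finally show ?thesis .
qed

text \<open>
  The cylinder lies inside cylinders over arbitrarily large finite subsets of \<open>I\<close>, whose measures
  \<open>(1/2) ^ n\<close> tend to \<open>0\<close>.
\<close>

lemma cylinder_infinite_null:
  assumes "infinite I"
  shows "cylinder I s \<in> null_sets cantor_measure"
proof -
  have "emeasure cantor_measure (cylinder I s) \<le> ennreal ((1/2) ^ n)" for n
  proof -
    obtain F where F: "finite F" "card F = n" "F \<subseteq> I"
      using infinite_arbitrarily_large[OF assms] by blast
    have "emeasure cantor_measure (cylinder I s) \<le> emeasure cantor_measure (cylinder F s)"
      using F by (intro emeasure_mono closed_in_sets_cantor closed_cylinder)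
        (auto simp: cylinder_def)
    also have "\<dots> = ennreal ((1/2) ^ n)"
      using F by (simp only: emeasure_cylinder)
    finally show ?thesis .
  qed
  moreover have "(\<lambda>n. ennreal ((1/2) ^ n)) \<longlonglongrightarrow> ennreal 0"
    by (intro tendsto_ennrealI LIMSEQ_realpow_zero) auto
  ultimately have "emeasure cantor_measure (cylinder I s) \<le> ennreal 0"
    using LIMSEQ_le_const by blast
  then show ?thesis
    by (intro null_setsI closed_in_sets_cantor closed_cylinder) simp
qed

section \<open>Coordinates that a positive set leaves free\<close>

text \<open>
  If \<open>A\<close> almost surely avoided the value \<open>b t\<close> at infinitely many coordinates \<open>t\<close>, then up to a
  countable union of null sets it would be contained in a cylinder over infinitely many
  coordinates, namely the one prescribing the opposite values.
\<close>

lemma finite_determined_coordinates: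
  assumes "A \<in> sets cantor_measure" "A \<notin> null_sets cantor_measure"
  shows "finite {t. \<exists>b. A \<inter> {x. x t = b} \<in> null_sets cantor_measure}" (is "finite ?I")
proof (rule ccontr)
  assume inf: "infinite ?I"
  have "\<exists>b. \<forall>t\<in>?I. A \<inter> {x. x t = b t} \<in> null_sets cantor_measure"
    by (rule bchoice) blast
  then obtain b where b: "\<And>t. t \<in> ?I \<Longrightarrow> A \<inter> {x. x t = b t} \<in> null_sets cantor_measure"
    by blast
  have "(\<Union>t\<in>?I. A \<inter> {x. x t = b t}) \<in> null_sets cantor_measure"
    by (rule null_sets_UN'[OF _ b]) (rule countableI_type)
  then have "(\<Union>t\<in>?I. A \<inter> {x. x t = b t}) \<union> cylinder ?I (\<lambda>t. \<not> b t) \<in> null_sets cantor_measure"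
    using cylinder_infinite_null[OF inf] by (rule null_sets.Un)
  moreover have "A \<subseteq> (\<Union>t\<in>?I. A \<inter> {x. x t = b t}) \<union> cylinder ?I (\<lambda>t. \<not> b t)"
    by (auto simp: cylinder_def)
  ultimately have "A \<in> null_sets cantor_measure"
    using assms(1) by (blast intro: null_sets_subset)
  with assms(2) show False
    by contradiction
qed

definition all_patterns_positive :: "cantor set \<Rightarrow> nat set \<Rightarrow> bool" where
  "all_patterns_positive A F \<longleftrightarrow> (\<forall>s. A \<inter> cylinder F s \<notin> null_sets cantor_measure)"

text \<open>
  A coordinate \<open>t\<close> fails to extend \<open>F\<close> only if it is almost surely determined on one of the
  positive sets \<open>A \<inter> cylinder F s\<close>. As \<open>F\<close> is finite, there are finitely many such sets, and each
  determines finitely many coordinates.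
\<close>

lemma finite_not_all_patterns_positive_insert:
  assumes A: "A \<in> sets cantor_measure" and F: "finite F" "all_patterns_positive A F"
  shows "finite {t. \<not> all_patterns_positive A (insert t F)}"
proof -
  let ?bad = "\<lambda>B. {t. \<exists>b. B \<inter> {x. x t = b} \<in> null_sets cantor_measure}"
  \<comment> \<open>A cylinder depends only on the values of \<open>s\<close> on \<open>F\<close>.\<close>
  have "cylinder F s \<in> cylinder F ` (\<Pi>\<^sub>E i\<in>F. UNIV)" for s
    by (rule image_eqI[of _ _ "restrict s F"]) (auto simp: cylinder_def)
  then have "range (cylinder F) \<subseteq> cylinder F ` (\<Pi>\<^sub>E i\<in>F. UNIV)"
    by blast
  then have fin: "finite (range (cylinder F))"
    using F(1) by (elim finite_subset) (intro finite_imageI finite_PiE, simp_all)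
  have "finite (?bad (A \<inter> B))" if "B \<in> range (cylinder F)" for B
    using that A F closed_in_sets_cantor[OF closed_cylinder]
    by (intro finite_determined_coordinates) (auto simp: all_patterns_positive_def)
  with fin have "finite (\<Union>B\<in>range (cylinder F). ?bad (A \<inter> B))"
    by blast
  moreover have "{t. \<not> all_patterns_positive A (insert t F)} \<subseteq> (\<Union>B\<in>range (cylinder F). ?bad (A \<inter> B))"
  proof
    fix t assume "t \<in> {t. \<not> all_patterns_positive A (insert t F)}"
    then obtain s where "A \<inter> cylinder (insert t F) s \<in> null_sets cantor_measure"
      by (auto simp: all_patterns_positive_def)
    moreover have "A \<inter> cylinder (insert t F) s = A \<inter> cylinder F s \<inter> {x. x t = s t}"
      by (auto simp: cylinder_def)
    ultimately show "t \<in> (\<Union>B\<in>range (cylinder F). ?bad (A \<inter> B))"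
      by auto
  qed
  ultimately show ?thesis
    by (rule rev_finite_subset)
qed

text \<open>
  The set \<open>T\<close> is the union of a strictly increasing chain of finite sets with all patterns
  positive. A finite subset of \<open>T\<close> lies in a member of the chain, and passing to fewer coordinates
  only enlarges the cylinders.
\<close>

lemma ex_infinite_all_patterns_positive:
  assumes A: "A \<in> sets cantor_measure" "A \<notin> null_sets cantor_measure"
  obtains T where "infinite T" "\<And>G. finite G \<Longrightarrow> G \<subseteq> T \<Longrightarrow> all_patterns_positive A G"
proof -
  have "\<exists>f. \<forall>n. (finite (f n) \<and> all_patterns_positive A (f n)) \<and> f n \<subset> f (Suc n)"
  proof (rule dependent_nat_choice[where P = "\<lambda>_ F. finite F \<and> all_patterns_positive A F"
        and Q = "\<lambda>_ F F'. F \<subset> F'"])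
    show "\<exists>F. finite F \<and> all_patterns_positive A F"
      using A by (intro exI[of _ "{}"]) (simp add: all_patterns_positive_def cylinder_def)
  next
    fix F and n :: nat assume F: "finite F \<and> all_patterns_positive A F"
    then have "finite (F \<union> {t. \<not> all_patterns_positive A (insert t F)})"
      using A finite_not_all_patterns_positive_insert by auto
    then obtain t where "t \<notin> F" "all_patterns_positive A (insert t F)"
      using ex_new_if_finite[OF infinite_UNIV_nat] by blast
    with F show "\<exists>F'. (finite F' \<and> all_patterns_positive A F') \<and> F \<subset> F'"
      by (intro exI[of _ "insert t F"]) auto
  qed
  then obtain f where f: "\<And>n. finite (f n)" "\<And>n. all_patterns_positive A (f n)"
      "\<And>n. f n \<subset> f (Suc n)"
    by blast
  have "strict_mono f"
    using f by (simp add: strict_mono_Suc_iff)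
  show thesis
  proof
    \<comment> \<open>A finite union would have only finitely many subsets, but the \<open>f n\<close> are all distinct.\<close>
    have "infinite (range f)"
      using \<open>strict_mono f\<close> by (simp add: range_inj_infinite strict_mono_imp_inj_on)
    moreover have "range f \<subseteq> Pow (\<Union>n. f n)"
      by blast
    ultimately show "infinite (\<Union>n. f n)"
      using finite_subset by blast
  next
    fix G assume G: "finite G" "G \<subseteq> (\<Union>n. f n)"
    have "subset.chain UNIV (range f)"
      using \<open>strict_mono f\<close>
      by (auto simp: subset_chain_def) (metis monoD nle_le strict_mono_mono subsetD)
    then obtain n where "G \<subseteq> f n"
      using finite_subset_Union_chain[OF G] by blast
    then have "A \<inter> cylinder (f n) s \<subseteq> A \<inter> cylinder G s" for s
      by (auto simp: cylinder_def)
    moreover have "A \<inter> cylinder (f n) s \<in> sets cantor_measure" for s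
      using A closed_in_sets_cantor[OF closed_cylinder] by blast
    ultimately show "all_patterns_positive A G"
      using f(2)[of n] null_sets_subset unfolding all_patterns_positive_def by blast
  qed
qed

text \<open>
  Sets of positive measure are nonempty, so every finite pattern on \<open>T\<close> occurs in \<open>C\<close>; the infinite
  patterns then occur by the finite intersection property.
\<close>

lemma closed_positive_ex_full_restriction:
  assumes C: "closed C" "C \<notin> null_sets cantor_measure"
  obtains T where "infinite T" "\<And>y. C \<inter> cylinder T y \<noteq> {}"
proof -
  obtain T where T: "infinite T" "\<And>G. finite G \<Longrightarrow> G \<subseteq> T \<Longrightarrow> all_patterns_positive C G"
    using ex_infinite_all_patterns_positive[OF closed_in_sets_cantor] C by metis
  have "C \<inter> cylinder T y \<noteq> {}" for y
  proof -
    have "compact C"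
      using closed_Int_compact[OF C(1) compact_UNIV_cantor] by simp
    then have "C \<inter> (\<Inter>i\<in>T. cylinder {i} y) \<noteq> {}"
    proof (rule compact_imp_fip_image)
      show "closed (cylinder {i} y)" for i
        by (rule closed_cylinder)
      fix G assume "finite G" "G \<subseteq> T"
      then have "C \<inter> cylinder G y \<noteq> {}"
        using T(2)[of G] unfolding all_patterns_positive_def by (metis null_sets.empty_sets)
      then show "C \<inter> (\<Inter>i\<in>G. cylinder {i} y) \<noteq> {}"
        by (auto simp: cylinder_def)
    qed
    then show ?thesis
      by (auto simp: cylinder_def)
  qed
  with T(1) that show thesis by blast
qed

section \<open>Comparing the two families\<close>

lemma UNIV_notin_ideal_E: "UNIV \<notin> ideal_E"
proof
  assume "UNIV \<in> ideal_E"
  then obtain F :: "nat \<Rightarrow> cantor set" where F: "\<And>n. F n \<in> null_sets cantor_measure" "(\<Union>n. F n) = UNIV"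
    unfolding ideal_E_def by blast
  then have "UNIV \<in> null_sets cantor_measure"
    by (metis null_sets_UN)
  then show False
    using emeasure_cylinder[of "{}"] by (simp add: cylinder_def null_sets_def)
qed

lemma cantor_on_notin_ideal_E_on: "cantor_on S \<notin> ideal_E_on S"
proof -
  have "relabel S -` cantor_on S = UNIV"
    by (auto simp: relabel_def cantor_on_def)
  then show ?thesis
    using UNIV_notin_ideal_E by (simp add: ideal_E_on_def)
qed

text \<open>
  The pullback of a restriction to \<open>S\<close> is a continuous image of the original set, and so inherits
  its compactness.
\<close>

lemma relabel_vimage_restrict_set:
  assumes "infinite S"
  shows "relabel S -` restrict_set X S = (\<lambda>z i. z (enumerate S i)) ` X"
proof -
  have "relabel S x = restrict z S \<longleftrightarrow> x = (\<lambda>i. z (enumerate S i))" for x z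
  proof
    assume "relabel S x = restrict z S"
    then show "x = (\<lambda>i. z (enumerate S i))"
      using assms by (metis (lifting) ext enumerate_in_set relabel_enumerate restrict_apply')
  next
    assume "x = (\<lambda>i. z (enumerate S i))"
    then show "relabel S x = restrict z S"
      using assms by (auto simp: relabel_def fun_eq_iff f_inv_into_f range_enumerate)
  qed
  then show ?thesis
    by (auto simp: restrict_set_def)
qed

lemma closed_enumerate_image:
  fixes X :: "cantor set"
  assumes "closed X"
  shows "closed ((\<lambda>z i. z (enumerate S i)) ` X :: cantor set)"
proof (intro compact_imp_closed_cantor compact_continuous_image)
  show "continuous_on X (\<lambda>z i. z (enumerate S i))"
    by (intro continuous_on_coordinatewise_then_product)
      (rule continuous_on_subset[OF continuous_on_product_coordinates], simp)
  show "compact X"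
    using closed_Int_compact[OF assms compact_UNIV_cantor] by simp
qed

text \<open>
  An infinite \<open>T\<close> on which the pulled-back set \<open>C\<close> takes all patterns is transported by the
  enumeration of \<open>S\<close> to an infinite subset of \<open>S\<close> on which \<open>X\<close> takes all patterns. Hence \<open>C\<close>
  must be null.
\<close>

lemma closed_P2_imp_EE:
  assumes "closed X" "X \<in> P2"
  shows "X \<in> EE"
  unfolding EE_def
proof (intro CollectI allI impI)
  fix S :: "nat set" assume S: "infinite S"
  define C :: "cantor set" where "C = (\<lambda>z i. z (enumerate S i)) ` X"
  have C: "closed C"
    unfolding C_def by (rule closed_enumerate_image[OF assms(1)])
  have "C \<in> null_sets cantor_measure"
  proof (rule ccontr)
    assume "C \<notin> null_sets cantor_measure"
    then obtain T where T: "infinite T" "\<And>y. C \<inter> cylinder T y \<noteq> {}"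
      using closed_positive_ex_full_restriction C by metis
    let ?T = "enumerate S ` T"
    have "infinite ?T"
      using T(1) S by (simp add: finite_image_iff strict_mono_enumerate strict_mono_imp_inj_on inj_on_subset)
    moreover have "restrict_set X ?T = cantor_on ?T"
    proof
      show "restrict_set X ?T \<subseteq> cantor_on ?T"
        by (auto simp: restrict_set_def cantor_on_def)
      show "cantor_on ?T \<subseteq> restrict_set X ?T"
      proof
        fix y assume y: "y \<in> cantor_on ?T"
        obtain z where "z \<in> X" "\<forall>i\<in>T. z (enumerate S i) = y (enumerate S i)"
          using T(2)[of "\<lambda>i. y (enumerate S i)"] by (auto simp: C_def cylinder_def)
        moreover from this y have "y = restrict z ?T"
          by (auto simp: cantor_on_def PiE_def extensional_def fun_eq_iff)
        ultimately show "y \<in> restrict_set X ?T"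
          by (auto simp: restrict_set_def)
      qed
    qed
    ultimately show False
      using assms(2) by (simp add: P2_def)
  qed
  with C have "C \<in> ideal_E"
    unfolding ideal_E_def by (intro CollectI exI[of _ "\<lambda>_. C"]) auto
  moreover have "relabel S -` restrict_set X S = C"
    unfolding C_def by (rule relabel_vimage_restrict_set[OF S])
  moreover have "restrict_set X S \<subseteq> cantor_on S"
    by (auto simp: restrict_set_def cantor_on_def)
  ultimately show "restrict_set X S \<in> ideal_E_on S"
    by (simp add: ideal_E_on_def)
qed

theorem corollary3p5:
  shows "EE \<inter> Perf = P2 \<inter> Perf"
proof -
  have "EE \<subseteq> P2"
    using cantor_on_notin_ideal_E_on by (force simp: EE_def P2_def)
  moreover have "P2 \<inter> Perf \<subseteq> EE"
    using closed_P2_imp_EE by (auto simp: Perf_def)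
  ultimately show ?thesis
    by blast
qed

end
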